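(* Let $g\ge 2$ and $m\ge 1$ be integers and let $\mathsf{C}_m$ be the cyclic group of order $m$. The number $N_g^{\circ}(\mathsf{C}_m)$ of admissible epimorphisms $\varphi\colon\mathsf{B}_2(\Sigma_g)\to\mathsf{C}_m$, up to automorphisms of $\mathsf{C}_m$, is $$N_g^{\circ}(\mathsf{C}_m)=\frac{1}{\phi(m)}N_g(\mathsf{C}_m),$$ where $N_g(\mathsf{C}_m)$ is the total number of admissible epimorphisms $\mathsf{B}_2(\Sigma_g)\to\mathsf{C}_m$ and $\phi$ is Euler's totient function.
   Context: Commutators are $[x,y]=xyx^{-1}y^{-1}$. Let $\Sigma_g$ be a compact Riemann surface of genus $g$. The full braid group on two strings $\mathsf{B}_2(\Sigma_g)\simeq\pi_1(\operatorname{Sym}^2\Sigma_g-\delta)$ (with $\delta$ the diagonal) is the group generated by $a_1,b_1,\dots,a_g,b_g,\sigma$ subject to the relations: $[a_i,\sigma^{-1}a_i\sigma^{-1}]=1$ and $[b_i,\sigma^{-1}b_i\sigma^{-1}]=1$ for $1\le i\le g$; $[a_i,\sigma^{-1}a_j\sigma]=[a_i,\sigma^{-1}b_j\sigma]=[b_i,\sigma^{-1}a_j\sigma]=[b_i,\sigma^{-1}b_j\sigma]=1$ for $j<i$; $[a_i,\sigma^{-1}b_i\sigma^{-1}]=\sigma^2$ for $1\le i\le g$; and $[a_1,b_1^{-1}]\cdots[a_g,b_g^{-1}]=\sigma^2$. For a finite group $G$, a group epimorphism $\varphi\colon\mathsf{B}_2(\Sigma_g)\to G$ is called admissible if $\varphi(\sigma)$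 has order $n\ge 2$ (i.e. $\varphi(\sigma)\neq 1$). $N_g^{\circ}(G)$ is the number of orbits of $\operatorname{Aut}(G)$ acting by post-composition on the set of admissible epimorphisms $\mathsf{B}_2(\Sigma_g)\to G$. *)

theory Defs
  imports
    "HOL-Algebra.Elementary_Groups"
    "HOL-Algebra.Group_Action"
    "HOL-Algebra.Multiplicative_Group"
    "HOL-Number_Theory.Totient"
begin

section \<open>Groups given by generators and relations\<close>

text \<open>A letter \<open>(x, True)\<close> stands for the generator \<open>x\<close>, a letter \<open>(x, False)\<close> for its inverse.
  Relations are pairs of words; \<open>(r, s)\<close> is the relation \<open>r = s\<close>.\<close>

type_synonym 'x word = "('x \<times> bool) list"

definition words :: "'x set \<Rightarrow> 'x word set"
  where "words S = lists (S \<times> UNIV)"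

definition word_inv :: "'x word \<Rightarrow> 'x word"
  where "word_inv w = rev (map (\<lambda>(x, e). (x, \<not> e)) w)"

definition word_comm :: "'x word \<Rightarrow> 'x word \<Rightarrow> 'x word"
  where "word_comm u v = u @ v @ word_inv u @ word_inv v"

inductive_set word_cong :: "'x set \<Rightarrow> ('x word \<times> 'x word) set \<Rightarrow> ('x word \<times> 'x word) set"
  for S :: "'x set" and R :: "('x word \<times> 'x word) set"
  where
    refl: "w \<in> words S \<Longrightarrow> (w, w) \<in> word_cong S R"
  | sym: "(v, w) \<in> word_cong S R \<Longrightarrow> (w, v) \<in> word_cong S R"
  | trans: "(u, v) \<in> word_cong S R \<Longrightarrow> (v, w) \<in> word_cong S R \<Longrightarrow> (u, w) \<in> word_cong S R"
  | cancel: "u \<in> words S \<Longrightarrow> v \<in> words S \<Longrightarrow> x \<in> S \<Longrightarrow>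
      (u @ [(x, e), (x, \<not> e)] @ v, u @ v) \<in> word_cong S R"
  | rel: "u \<in> words S \<Longrightarrow> v \<in> words S \<Longrightarrow> (r, s) \<in> R \<Longrightarrow> r \<in> words S \<Longrightarrow> s \<in> words S \<Longrightarrow>
      (u @ r @ v, u @ s @ v) \<in> word_cong S R"

definition word_class :: "'x set \<Rightarrow> ('x word \<times> 'x word) set \<Rightarrow> 'x word \<Rightarrow> 'x word set"
  where "word_class S R w = word_cong S R `` {w}"

definition presented_group :: "'x set \<Rightarrow> ('x word \<times> 'x word) set \<Rightarrow> 'x word set monoid"
  where "presented_group S R =
    \<lparr>carrier = words S // word_cong S R,
     monoid.mult = \<lambda>P Q. \<Union>u\<in>P. \<Union>v\<in>Q. word_class S R (u @ v),
     one = word_class S R []\<rparr>"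

lemma words_Nil [simp]: "[] \<in> words S"
  and words_Cons [simp]: "p # w \<in> words S \<longleftrightarrow> fst p \<in> S \<and> w \<in> words S"
  and words_append [simp]: "u @ v \<in> words S \<longleftrightarrow> u \<in> words S \<and> v \<in> words S"
  by (auto simp: words_def mem_Times_iff)

lemma word_inv_words [simp]: "word_inv w \<in> words S \<longleftrightarrow> w \<in> words S"
  by (force simp: words_def word_inv_def in_lists_conv_set)

lemma word_comm_words [simp]: "word_comm u v \<in> words S \<longleftrightarrow> u \<in> words S \<and> v \<in> words S"
  by (auto simp: word_comm_def)

lemma word_cong_words: "(u, v) \<in> word_cong S R \<Longrightarrow> u \<in> words S \<and> v \<in> words S"
  by (induction rule: word_cong.induct) auto

lemma equiv_word_cong: "equiv (words S) (word_cong S R)"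
proof (rule equivI)
  show "word_cong S R \<subseteq> words S \<times> words S"
    by (auto dest: word_cong_words)
  show "refl_on (words S) (word_cong S R)"
    by (simp add: refl_onI word_cong.refl)
  show "sym (word_cong S R)"
    by (rule symI) (rule word_cong.sym)
  show "trans (word_cong S R)"
    by (rule transI) (rule word_cong.trans)
qed

lemma word_cong_context:
  assumes "(u, v) \<in> word_cong S R" "p \<in> words S" "q \<in> words S"
  shows "(p @ u @ q, p @ v @ q) \<in> word_cong S R"
  using assms
proof (induction rule: word_cong.induct)
  case (cancel u v x e)
  then show ?case using word_cong.cancel[of "p @ u" S "v @ q" x e R] by simp
next
  case (rel u v r s)
  then show ?case using word_cong.rel[of "p @ u" S "v @ q" r s R] by simp
next
  case (sym v w)
  then show ?case by (simp add: word_cong.sym)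
next
  case (trans u v w)
  then show ?case by (meson word_cong.trans)
qed (simp add: word_cong.refl)

lemma word_cong_append:
  assumes "(u, u') \<in> word_cong S R" "(v, v') \<in> word_cong S R"
  shows "(u @ v, u' @ v') \<in> word_cong S R"
proof -
  have "(u @ v, u' @ v) \<in> word_cong S R"
    using word_cong_context[OF assms(1), of "[]" v] assms[THEN word_cong_words] by simp
  moreover have "(u' @ v, u' @ v') \<in> word_cong S R"
    using word_cong_context[OF assms(2), of u' "[]"] assms[THEN word_cong_words] by simp
  ultimately show ?thesis by (rule word_cong.trans)
qed

lemma word_class_eq_iff:
  assumes "u \<in> words S" "v \<in> words S"
  shows "word_class S R u = word_class S R v \<longleftrightarrow> (u, v) \<in> word_cong S R"
  using eq_equiv_class_iff[OF equiv_word_cong assms] by (simp add: word_class_def)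

lemma carrier_presented_group: "carrier (presented_group S R) = word_class S R ` words S"
  by (auto simp: presented_group_def quotient_def word_class_def)

lemma one_presented_group: "\<one>\<^bsub>presented_group S R\<^esub> = word_class S R []"
  by (simp add: presented_group_def)

lemma mult_presented_group:
  assumes "u \<in> words S" "v \<in> words S"
  shows "word_class S R u \<otimes>\<^bsub>presented_group S R\<^esub> word_class S R v = word_class S R (u @ v)"
proof -
  have "word_class S R (u' @ v') = word_class S R (u @ v)"
    if "u' \<in> word_class S R u" "v' \<in> word_class S R v" for u' v'
  proof -
    have uv: "(u @ v, u' @ v') \<in> word_cong S R"
      using that by (intro word_cong_append) (simp_all add: word_class_def)
    then show ?thesis
      using word_class_eq_iff[of "u' @ v'" S "u @ v" R] word_cong_words[OF uv]
      by (simp add: word_cong.sym)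
  qed
  moreover have "u \<in> word_class S R u" "v \<in> word_class S R v"
    using assms by (simp_all add: word_class_def word_cong.refl)
  ultimately have "(\<Union>u'\<in>word_class S R u. \<Union>v'\<in>word_class S R v. word_class S R (u' @ v')) =
      word_class S R (u @ v)"
    by blast
  then show ?thesis
    by (simp add: presented_group_def)
qed

lemma word_inv_left:
  assumes "w \<in> words S"
  shows "(word_inv w @ w, []) \<in> word_cong S R"
  using assms
proof (induction w)
  case Nil
  then show ?case by (simp add: word_inv_def word_cong.refl)
next
  case (Cons p w)
  obtain x e where p: "p = (x, e)" by (cases p)
  have "(word_inv w @ [(x, \<not> e), (x, \<not> \<not> e)] @ w, word_inv w @ w) \<in> word_cong S R"
    using Cons.prems p by (intro word_cong.cancel) auto
  moreover have "(word_inv w @ w, []) \<in> word_cong S R"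
    using Cons by simp
  ultimately show ?case
    using p word_cong.trans by (fastforce simp: word_inv_def)
qed

theorem group_presented_group: "group (presented_group S R)"
proof (rule groupI)
  show "\<exists>y\<in>carrier (presented_group S R). y \<otimes>\<^bsub>presented_group S R\<^esub> x = \<one>\<^bsub>presented_group S R\<^esub>"
    if x: "x \<in> carrier (presented_group S R)" for x
  proof -
    obtain w where w: "w \<in> words S" "x = word_class S R w"
      using x by (auto simp: carrier_presented_group)
    then show ?thesis
      using word_inv_left[OF w(1), of R]
      by (intro bexI[of _ "word_class S R (word_inv w)"])
         (auto simp: carrier_presented_group mult_presented_group one_presented_group
            word_class_eq_iff)
  qed
qed (auto simp: carrier_presented_group mult_presented_group one_presented_group)

lemma relation_presented_group:
  assumes "(r, s) \<in> R" "r \<in> words S" "s \<in> words S"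
  shows "word_class S R r = word_class S R s"
  using assms word_cong.rel[of "[]" S "[]" r s R] by (simp add: word_class_eq_iff)


section \<open>The braid group on two strings of a surface\<close>

datatype braid_gen = Gen_a nat | Gen_b nat | Gen_sigma

abbreviation letter :: "'x \<Rightarrow> 'x word"
  where "letter x \<equiv> [(x, True)]"

definition braid2_gens :: "nat \<Rightarrow> braid_gen set"
  where "braid2_gens g = Gen_a ` {1..g} \<union> Gen_b ` {1..g} \<union> {Gen_sigma}"

definition braid2_rels :: "nat \<Rightarrow> (braid_gen word \<times> braid_gen word) set"
  where "braid2_rels g =
    (let a = (\<lambda>i. letter (Gen_a i)); b = (\<lambda>i. letter (Gen_b i));
         s = letter Gen_sigma; s' = word_inv s
     in {(word_comm (a i) (s' @ a i @ s'), []) | i. i \<in> {1..g}}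
      \<union> {(word_comm (b i) (s' @ b i @ s'), []) | i. i \<in> {1..g}}
      \<union> {(word_comm (a i) (s' @ a j @ s), []) | i j. i \<in> {1..g} \<and> j \<in> {1..g} \<and> j < i}
      \<union> {(word_comm (a i) (s' @ b j @ s), []) | i j. i \<in> {1..g} \<and> j \<in> {1..g} \<and> j < i}
      \<union> {(word_comm (b i) (s' @ a j @ s), []) | i j. i \<in> {1..g} \<and> j \<in> {1..g} \<and> j < i}
      \<union> {(word_comm (b i) (s' @ b j @ s), []) | i j. i \<in> {1..g} \<and> j \<in> {1..g} \<and> j < i}
      \<union> {(word_comm (a i) (s' @ b i @ s'), s @ s) | i. i \<in> {1..g}}
      \<union> {(concat (map (\<lambda>i. word_comm (a i) (word_inv (b i))) [1..<Suc g]), s @ s)})"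

definition braid2_group :: "nat \<Rightarrow> braid_gen word set monoid"
  where "braid2_group g = presented_group (braid2_gens g) (braid2_rels g)"

definition braid2_sigma :: "nat \<Rightarrow> braid_gen word set"
  where "braid2_sigma g = word_class (braid2_gens g) (braid2_rels g) (letter Gen_sigma)"

lemma group_braid2_group: "group (braid2_group g)"
  unfolding braid2_group_def by (rule group_presented_group)

lemma braid2_rels_words:
  assumes "(r, s) \<in> braid2_rels g"
  shows "r \<in> words (braid2_gens g)" "s \<in> words (braid2_gens g)"
proof -
  have "concat ws \<in> words S" if "set ws \<subseteq> words S" for ws :: "braid_gen word list" and S
    using that by (induction ws) auto
  then show "r \<in> words (braid2_gens g)" "s \<in> words (braid2_gens g)"
    using assms by (auto simp: braid2_rels_def Let_def braid2_gens_def image_subset_iff)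
qed


section \<open>Admissible epimorphisms\<close>

text \<open>Homomorphisms are required to be extensional, so that each of them is counted once: the
  values of a HOL function outside the carrier are irrelevant.\<close>

definition admissible_epis :: "nat \<Rightarrow> ('c, 'd) monoid_scheme \<Rightarrow> (braid_gen word set \<Rightarrow> 'c) set"
  where "admissible_epis g G =
    {\<phi> \<in> epi (braid2_group g) G \<inter> extensional (carrier (braid2_group g)).
      group.ord G (\<phi> (braid2_sigma g)) \<ge> 2}"

definition num_admissible_epis :: "nat \<Rightarrow> ('c, 'd) monoid_scheme \<Rightarrow> nat"
  where "num_admissible_epis g G = card (admissible_epis g G)"

definition num_admissible_epis_mod_aut :: "nat \<Rightarrow> ('c, 'd) monoid_scheme \<Rightarrow> nat"
  where "num_admissible_epis_mod_aut g G =
    card (orbits (AutoGroup G) (admissible_epis g G) (compose (carrier (braid2_group g))))"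

text \<open>For a finite group \<open>G\<close> both cardinalities are therefore genuine.\<close>

lemma finite_admissible_epis:
  assumes "group G" "finite (carrier G)"
  shows "finite (admissible_epis g G)"
proof -
  let ?S = "braid2_gens g" and ?R = "braid2_rels g" and ?B = "braid2_group g"
  let ?c = "\<lambda>w. word_class ?S ?R w"
  let ?L = "?S \<times> (UNIV :: bool set)"
  let ?val = "\<lambda>\<phi>. \<lambda>p\<in>?L. \<phi> (?c [p])"
  have fin: "finite (?L \<rightarrow>\<^sub>E carrier G)"
    using assms by (intro finite_PiE) (auto simp: braid2_gens_def)
  have car: "?c w \<in> carrier ?B" if "w \<in> words ?S" for w
    using that by (auto simp: braid2_group_def carrier_presented_group)
  have "?val ` admissible_epis g G \<subseteq> ?L \<rightarrow>\<^sub>E carrier G"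
    using car by (force simp: admissible_epis_def epi_def hom_def Pi_iff)
  moreover have "inj_on ?val (admissible_epis g G)"
  proof (rule inj_onI)
    fix \<phi> \<psi>
    assume \<phi>: "\<phi> \<in> admissible_epis g G" and \<psi>: "\<psi> \<in> admissible_epis g G"
      and eq: "?val \<phi> = ?val \<psi>"
    have hom: "\<phi> \<in> hom ?B G" "\<psi> \<in> hom ?B G"
      using \<phi> \<psi> by (auto simp: admissible_epis_def epi_def)
    have one: "\<phi> (?c []) = \<psi> (?c [])"
      using hom_one[OF hom(1) group_braid2_group assms(1)]
        hom_one[OF hom(2) group_braid2_group assms(1)]
      by (simp add: braid2_group_def one_presented_group)
    have "\<phi> (?c w) = \<psi> (?c w)" if "w \<in> words ?S" for w
      using that
    proof (induction w)
      case (Cons p w)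
      have c: "?c (p # w) = ?c [p] \<otimes>\<^bsub>?B\<^esub> ?c w"
        using Cons.prems by (simp add: braid2_group_def mult_presented_group)
      have "\<phi> (?c [p]) = \<psi> (?c [p])"
        using fun_cong[OF eq, of p] Cons.prems by (cases p) (simp add: restrict_def)
      then show ?case
        unfolding c using Cons car[of "[p]"] car[of w] hom by (simp add: hom_mult)
    qed (rule one)
    then have "\<phi> x = \<psi> x" if "x \<in> carrier ?B" for x
      using that by (auto simp: braid2_group_def carrier_presented_group)
    then show "\<phi> = \<psi>"
      using \<phi> \<psi> by (intro extensionalityI[of _ "carrier ?B"]) (auto simp: admissible_epis_def)
  qed
  ultimately show ?thesis
    using fin by (meson finite_imageD finite_subset)
qed

end

theory Submission
  imports Defs
begin

text \<open>An automorphism that fixes an epimorphism \<open>\<phi>\<close> onto \<open>G\<close> under post-composition fixes every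
  value of \<open>\<phi>\<close>, hence all of \<open>G\<close>. So \<open>Aut G\<close> acts freely on the admissible epimorphisms, which it
  permutes because it preserves surjectivity and element orders, and every orbit has exactly
  \<open>|Aut G|\<close> elements (\<open>order_AutoGroup_times_num_admissible_epis_mod_aut\<close>).

  What is special about cyclic groups is the size of the automorphism group: an endomorphism of a
  cyclic group of order \<open>m\<close> is a power map \<open>x \<mapsto> x\<^sup>k\<close>, with \<open>k\<close> determined modulo \<open>m\<close>, and it is
  bijective iff \<open>k\<close> is coprime to \<open>m\<close>. Hence \<open>|Aut C\<^sub>m| = totient m\<close>
  (\<open>order_AutoGroup_cyclic\<close>), and dividing gives the claim.\<close>

text \<open>The action is given by plain closure and composition laws, rather than as a homomorphism into
  a group of extensional bijections of \<open>E\<close>, so that post-composition of functions is an instance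
  without being restricted to \<open>E\<close>.\<close>

lemma order_times_card_orbits_free_action:
  assumes "group H" and "finite E"
    and closed: "\<And>h x. h \<in> carrier H \<Longrightarrow> x \<in> E \<Longrightarrow> act h x \<in> E"
    and one: "\<And>x. x \<in> E \<Longrightarrow> act \<one>\<^bsub>H\<^esub> x = x"
    and mult: "\<And>h k x. h \<in> carrier H \<Longrightarrow> k \<in> carrier H \<Longrightarrow> x \<in> E \<Longrightarrow>
      act (h \<otimes>\<^bsub>H\<^esub> k) x = act h (act k x)"
    and free: "\<And>h k x. h \<in> carrier H \<Longrightarrow> k \<in> carrier H \<Longrightarrow> x \<in> E \<Longrightarrow> act h x = act k x \<Longrightarrow> h = k"
  shows "order H * card (orbits H E act) = card E"
proof -
  interpret group H by fact
  have orbit_image: "orbit H act x = (\<lambda>h. act h x) ` carrier H" for x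
    by (auto simp: orbit_def)
  have in_orbit: "x \<in> orbit H act x" if "x \<in> E" for x
    unfolding orbit_image using one[OF that] by (metis image_eqI one_closed)
  have orbit_subset: "orbit H act x \<subseteq> E" if "x \<in> E" for x
    using closed that by (auto simp: orbit_image)
  have cover: "\<Union> (orbits H E act) = E"
    using in_orbit orbit_subset by (auto simp: orbits_def)
  have orbit_le: "orbit H act (act h x) \<subseteq> orbit H act x" if "h \<in> carrier H" "x \<in> E" for h x
    using that by (auto simp: orbit_image simp flip: mult)
  have orbit_act: "orbit H act (act h x) = orbit H act x" if hx: "h \<in> carrier H" "x \<in> E" for h x
  proof (rule equalityI[OF orbit_le[OF hx]])
    have "act (inv\<^bsub>H\<^esub> h) (act h x) = x"
      using hx one by (simp flip: mult)
    then show "orbit H act x \<subseteq> orbit H act (act h x)"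
      using orbit_le[of "inv\<^bsub>H\<^esub> h" "act h x"] hx closed by simp
  qed
  have orbit_eq: "A = orbit H act z" if A: "A \<in> orbits H E act" and z: "z \<in> A" for A z
  proof -
    obtain x where x: "x \<in> E" "A = orbit H act x"
      using A by (auto simp: orbits_def)
    then obtain h where "h \<in> carrier H" "z = act h x"
      using z by (auto simp: orbit_def)
    with x orbit_act show ?thesis by simp
  qed
  have "order H * card (orbits H E act) = card (\<Union> (orbits H E act))"
  proof (rule card_partition)
    show "finite (orbits H E act)"
      using \<open>finite E\<close> by (simp add: orbits_def Setcompr_eq_image)
    show "finite (\<Union> (orbits H E act))"
      using \<open>finite E\<close> by (simp add: cover)
    show "card A = order H" if "A \<in> orbits H E act" for A
      using that free
      by (auto simp: orbits_def orbit_image order_def inj_on_def intro!: card_image)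
    show "A \<inter> B = {}" if "A \<in> orbits H E act" "B \<in> orbits H E act" "A \<noteq> B" for A B
      using that orbit_eq by blast
  qed
  with cover show ?thesis by simp
qed

lemma (in group) ord_hom_inj:
  assumes "group H" "h \<in> hom G H" "inj_on h (carrier G)" "x \<in> carrier G"
  shows "group.ord H (h x) = ord x"
proof -
  interpret h: group_hom G H h
    using assms by (simp add: group_hom_def group_hom_axioms_def is_group)
  have "h x [^]\<^bsub>H\<^esub> n = \<one>\<^bsub>H\<^esub> \<longleftrightarrow> x [^] n = \<one>" for n :: nat
    using assms inj_onD[OF assms(3), of "x [^] n" \<one>] by (auto simp flip: h.hom_nat_pow)
  then show ?thesis
    using assms by (subst h.H.ord_unique) (auto simp: pow_eq_id)
qed

lemma carrier_AutoGroup: "carrier (AutoGroup G) = auto G"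
  by (simp add: AutoGroup_def)

lemma compose_admissible_epis:
  assumes "group G" and h: "h \<in> auto G" and \<phi>: "\<phi> \<in> admissible_epis g G"
  shows "compose (carrier (braid2_group g)) h \<phi> \<in> admissible_epis g G"
proof -
  let ?B = "braid2_group g"
  interpret G: group G by fact
  interpret B: group ?B by (rule group_braid2_group)
  have sigma: "braid2_sigma g \<in> carrier ?B"
    by (auto simp: braid2_sigma_def braid2_group_def carrier_presented_group braid2_gens_def)
  have hom: "h \<in> hom G G" "\<phi> \<in> hom ?B G" and bij: "bij_betw h (carrier G) (carrier G)"
    and surj: "\<phi> ` carrier ?B = carrier G" and ord: "G.ord (\<phi> (braid2_sigma g)) \<ge> 2"
    using h \<phi> by (auto simp: auto_def Bij_def admissible_epis_def epi_def)
  have "\<phi> (braid2_sigma g) \<in> carrier G"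
    using surj sigma by blast
  then have "G.ord (h (\<phi> (braid2_sigma g))) = G.ord (\<phi> (braid2_sigma g))"
    using bij by (intro G.ord_hom_inj[OF \<open>group G\<close> hom(1)]) (simp_all add: bij_betw_def)
  moreover have "compose (carrier ?B) h \<phi> \<in> hom ?B G"
    using B.hom_compose[OF hom(2,1)] .
  moreover have "compose (carrier ?B) h \<phi> ` carrier ?B = carrier G"
    using surj bij by (simp add: compose_def bij_betw_def flip: image_image)
  ultimately show ?thesis
    using sigma ord by (simp add: admissible_epis_def epi_def compose_eq)
qed

lemma order_AutoGroup_times_num_admissible_epis_mod_aut:
  assumes "group G" and "finite (carrier G)"
  shows "order (AutoGroup G) * num_admissible_epis_mod_aut g G = num_admissible_epis g G"
  unfolding num_admissible_epis_mod_aut_def num_admissible_epis_def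
proof (rule order_times_card_orbits_free_action)
  let ?B = "braid2_group g"
  interpret G: group G by fact
  show "group (AutoGroup G)" by (rule G.AutoGroup)
  show "finite (admissible_epis g G)"
    using assms by (rule finite_admissible_epis)
  fix \<phi> assume \<phi>: "\<phi> \<in> admissible_epis g G"
  then have surj: "\<phi> ` carrier ?B = carrier G" and ext: "\<phi> \<in> extensional (carrier ?B)"
    by (auto simp: admissible_epis_def epi_def)
  then have car: "\<phi> \<in> carrier ?B \<rightarrow> carrier G" by blast
  show "compose (carrier ?B) \<one>\<^bsub>AutoGroup G\<^esub> \<phi> = \<phi>"
    using car ext by (simp add: AutoGroup_def BijGroup_def)
  fix h assume h: "h \<in> carrier (AutoGroup G)"
  then show "compose (carrier ?B) h \<phi> \<in> admissible_epis g G"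
    using \<phi> assms by (simp add: carrier_AutoGroup compose_admissible_epis)
  fix k assume k: "k \<in> carrier (AutoGroup G)"
  have hk: "h \<in> Bij (carrier G)" "k \<in> Bij (carrier G)"
    using h k by (simp_all add: carrier_AutoGroup auto_def)
  then show "compose (carrier ?B) (h \<otimes>\<^bsub>AutoGroup G\<^esub> k) \<phi> =
      compose (carrier ?B) h (compose (carrier ?B) k \<phi>)"
    using compose_assoc[OF car, of h k] by (simp add: AutoGroup_def BijGroup_def)
  assume eq: "compose (carrier ?B) h \<phi> = compose (carrier ?B) k \<phi>"
  show "h = k"
  proof (rule extensionalityI)
    show "h \<in> extensional (carrier G)" "k \<in> extensional (carrier G)"
      using hk by (simp_all add: Bij_imp_extensional)
    fix y assume "y \<in> carrier G"
    then obtain x where "x \<in> carrier ?B" "y = \<phi> x" using surj by blast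
    then show "h y = k y"
      using fun_cong[OF eq, of x] by (simp add: compose_eq)
  qed
qed

lemma (in group) cyclic_group_generator_pow:
  assumes "cyclic_group G" and "finite (carrier G)"
  obtains a where "a \<in> carrier G" and "carrier G = {a [^] k | k :: nat. True}" and "ord a = order G"
proof -
  obtain a where a: "a \<in> carrier G" and gen: "subgroup_generated G {a} = G"
    using assms by (auto simp: cyclic_group_def)
  have "carrier G = generate G {a}"
    using a arg_cong[OF gen, of carrier] by (simp add: carrier_subgroup_generated)
  with a show thesis
    using that generate_pow_on_finite_carrier[OF assms(2) a] generate_pow_card[OF a]
    by (auto simp: order_def)
qed

text \<open>If \<open>x\<^sup>k = 1\<close>, then the order of \<open>x\<close> divides both \<open>k\<close> and the order of the group,
  so it is \<open>1\<close>: the power map has trivial kernel, and on a finite group that makes it bijective.\<close>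

lemma (in comm_group) coprime_power_map_in_auto:
  assumes fin: "finite (carrier G)" and cop: "coprime k (order G)"
  shows "(\<lambda>x\<in>carrier G. x [^] k) \<in> auto G"
proof -
  let ?p = "\<lambda>x\<in>carrier G. x [^] k"
  have hom: "?p \<in> hom G G"
    by (auto simp: hom_def pow_mult_distrib m_comm)
  then interpret p: group_hom G G ?p
    by unfold_locales
  have "x = \<one>" if "x \<in> carrier G" "x [^] k = \<one>" for x
  proof -
    have "ord x dvd k" "ord x dvd order G"
      using that fin pow_eq_id ord_dvd_group_order by auto
    then have "ord x = 1"
      using cop by (metis coprime_common_divisor_nat)
    with that show ?thesis using ord_eq_1 by blast
  qed
  then have "inj_on ?p (carrier G)"
    by (subst p.inj_on_one_iff) auto
  moreover have "?p ` carrier G \<subseteq> carrier G"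
    by auto
  ultimately have "bij_betw ?p (carrier G) (carrier G)"
    using endo_inj_surj[OF fin] by (simp add: bij_betw_def)
  with hom show ?thesis
    by (simp add: auto_def Bij_def)
qed

text \<open>An endomorphism \<open>h\<close> is determined by \<open>h a = a\<^sup>k\<close> for a generator \<open>a\<close>, which forces it to be the
  \<open>k\<close>-th power map. If \<open>h\<close> is bijective, then \<open>a\<^sup>k\<close> has the same order as \<open>a\<close>, which makes \<open>k\<close> coprime
  to the group order.\<close>

lemma order_AutoGroup_cyclic:
  assumes "group C" and "cyclic_group C" and fin: "finite (carrier C)"
  shows "order (AutoGroup C) = totient (order C)"
proof -
  interpret group C by fact
  interpret comm_group C using assms(2) by (rule cyclic_imp_abelian_group)
  obtain a where a: "a \<in> carrier C" and gen: "carrier C = {a [^]\<^bsub>C\<^esub> k | k :: nat. True}"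
    and ord_a: "ord a = order C"
    using cyclic_group_generator_pow[OF assms(2) fin] .
  let ?p = "\<lambda>k::nat. \<lambda>x\<in>carrier C. x [^]\<^bsub>C\<^esub> k"
  have "inj_on ?p (totatives (order C))"
  proof (rule inj_onI)
    fix k l assume kl: "k \<in> totatives (order C)" "l \<in> totatives (order C)" and "?p k = ?p l"
    then have "a [^]\<^bsub>C\<^esub> k = a [^]\<^bsub>C\<^esub> l"
      using a by (metis restrict_apply')
    then show "k = l"
      using kl inj_onD[OF ord_inj'[OF a], of k l] by (simp add: ord_a in_totatives_iff)
  qed
  moreover have "?p ` totatives (order C) = auto C"
  proof (rule equalityI)
    show "?p ` totatives (order C) \<subseteq> auto C"
      using coprime_power_map_in_auto[OF fin] by (auto simp: in_totatives_iff)
    show "auto C \<subseteq> ?p ` totatives (order C)"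
    proof
      fix h assume "h \<in> auto C"
      then have hom: "h \<in> hom C C" and ext: "h \<in> extensional (carrier C)"
        and inj: "inj_on h (carrier C)" and ha: "h a \<in> carrier C"
        using a by (auto simp: auto_def Bij_def bij_betw_def)
      interpret h: group_hom C C h
        using hom by unfold_locales
      have "order C > 0"
        using a fin by (auto simp: order_def card_gt_0_iff)
      obtain j :: nat where j: "h a = a [^]\<^bsub>C\<^esub> j"
        using ha gen by auto
      \<comment> \<open>The representative of \<open>j\<close> is taken in \<open>{1..m}\<close> rather than \<open>{0..<m}\<close>, so that the trivial
        group, whose only totative is \<open>1\<close>, is no exception.\<close>
      define k where "k = (if j mod order C = 0 then order C else j mod order C)"
      have "int (order C) dvd int k - int j"
        by (auto simp: k_def simp flip: mod_eq_dvd_iff zmod_int)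
      then have hk: "h a = a [^]\<^bsub>C\<^esub> k"
        using int_pow_eq[OF a, of "int j" "int k"] j by (simp add: ord_a int_pow_int)
      have "ord (a [^]\<^bsub>C\<^esub> k) = ord a"
        using ord_hom_inj[OF \<open>group C\<close> hom inj a] by (simp add: hk)
      then have "coprime k (order C)"
        using pow_ord_eq_ord_iff[OF fin a] by (simp add: ord_a)
      then have "k \<in> totatives (order C)"
        using \<open>order C > 0\<close> by (auto simp: in_totatives_iff k_def less_imp_le)
      moreover have "h = ?p k"
      proof (rule extensionalityI[OF ext])
        fix x assume "x \<in> carrier C"
        then obtain i :: nat where "x = a [^]\<^bsub>C\<^esub> i" using gen by auto
        then show "h x = ?p k x"
          using a by (simp add: h.hom_nat_pow hk nat_pow_pow mult.commute)
      qed simp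
      ultimately show "h \<in> ?p ` totatives (order C)" by blast
    qed
  qed
  ultimately have "card (auto C) = card (totatives (order C))"
    by (metis card_image)
  then show ?thesis
    by (simp add: order_def carrier_AutoGroup totient_def)
qed

theorem corollary4p4:
  fixes g m :: nat and C :: "'c monoid"
  assumes "g \<ge> 2" and "m \<ge> 1"
    and "group C" and "cyclic_group C" and "order C = m"
  shows "real (num_admissible_epis_mod_aut g C) =
    1 / real (totient m) * real (num_admissible_epis g C)"
proof -
  have fin: "finite (carrier C)"
    using assms by (intro card_ge_0_finite) (simp add: order_def)
  have "totient m * num_admissible_epis_mod_aut g C = num_admissible_epis g C"
    using order_AutoGroup_times_num_admissible_epis_mod_aut[OF \<open>group C\<close> fin]
      order_AutoGroup_cyclic[OF \<open>group C\<close> \<open>cyclic_group C\<close> fin] assms by simp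
  moreover have "real (totient m) > 0"
    using assms by simp
  ultimately show ?thesis
    by (simp add: field_simps flip: of_nat_mult)
qed

end
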